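(* Let $n\ge 1$ and $t\ge 0$. Then $\mathsf{H}^{*t}$ is a metric outer measure on $\mathbb{R}^n$ (that is, an outer measure such that $\mathsf{H}^{*t}(E\cup F)=\mathsf{H}^{*t}(E)+\mathsf{H}^{*t}(F)$ whenever $E,F\subset\mathbb{R}^n$ satisfy $\inf\{|x-y| : x\in E,\ y\in F\}>0$), and thus it is a measure on the Borel family of subsets of $\mathbb{R}^n$.
   Context: $\mathbb{R}^n$ carries the Euclidean distance. For a non-negative integer $k$, a (half-open) binary cube of side $2^{-k}$ in $\mathbb{R}^n$ is a set $C=I_1\times\cdots\times I_n$ where each $I_i=[p_i2^{-k},(p_i+1)2^{-k})$ with $p_i$ an integer. For $E\subset\mathbb{R}^n$, $N^*_{2^{-k}}(E)$ is the infimum of the numbers of elements of families of binary cubes of side $2^{-k}$ that cover $E$. For $t\ge 0$, $$\overline{\mathsf{H}}^{*t}_{2^{-k}}(E)=N^*_{2^{-k}}(E)\,2^{-kt},\qquad \overline{\mathsf{H}}^{*t}(E)=\liminf_{k\to+\infty}\overline{\mathsf{H}}^{*t}_{2^{-k}}(E),$$ $$\mathsf{H}^{*t}(E)=\inf\Big\{\sum_i\overline{\mathsf{H}}^{*t}(E_i) : E\subseteq\bigcup_iE_i\Big\},$$ the infimum being over countable families $(E_i)_i$ of subsets of $\mathbb{R}^n$ covering $E$. *)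

theory Defs
  imports "HOL-Analysis.Analysis"
begin

definition binary_cubes :: "nat \<Rightarrow> (real ^ 'n) set set" where
  "binary_cubes k =
     range (\<lambda>p :: 'n \<Rightarrow> int.
       {x. \<forall>i. x $ i \<in> {of_int (p i) * 2 powr - real k ..< (of_int (p i) + 1) * 2 powr - real k}})"

(* Counting measure is \<open>\<infinity>\<close> on infinite families, so the value is \<open>\<infinity>\<close> when E has no finite cover,
   i.e. when E is unbounded. *)
definition cube_number :: "nat \<Rightarrow> (real ^ 'n) set \<Rightarrow> ennreal" where
  "cube_number k E =
     (INF \<C>\<in>{\<C>. \<C> \<subseteq> binary_cubes k \<and> E \<subseteq> \<Union>\<C>}. emeasure (count_space UNIV) \<C>)"

definition box_premeasure_at :: "real \<Rightarrow> nat \<Rightarrow> (real ^ 'n) set \<Rightarrow> ennreal" where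
  "box_premeasure_at t k E = cube_number k E * ennreal (2 powr (- (real k * t)))"

definition box_premeasure :: "real \<Rightarrow> (real ^ 'n) set \<Rightarrow> ennreal" where
  "box_premeasure t E = liminf (\<lambda>k. box_premeasure_at t k E)"

(* Sequences suffice for all countable covers: a finite cover is padded with empty sets, which
   contribute 0 by \<open>box_premeasure_empty\<close> below. *)
definition box_measure :: "real \<Rightarrow> (real ^ 'n) set \<Rightarrow> ennreal" where
  "box_measure t E =
     (INF A\<in>{A :: nat \<Rightarrow> (real ^ 'n) set. E \<subseteq> (\<Union>i. A i)}. \<Sum>i. box_premeasure t (A i))"

lemma box_premeasure_empty: "box_premeasure t ({} :: (real ^ 'n) set) = 0"
proof -
  have "cube_number k ({} :: (real ^ 'n) set) \<le> emeasure (count_space UNIV) ({} :: (real ^ 'n) set set)"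
    for k unfolding cube_number_def by (rule INF_lower) auto
  then have "cube_number k ({} :: (real ^ 'n) set) = 0" for k by simp
  then show ?thesis
    by (simp add: box_premeasure_def box_premeasure_at_def Liminf_const)
qed

(* The infimum is taken in \<open>ennreal\<close>, where it is \<open>\<infinity>\<close> if E or F is empty;
   the real-valued \<open>setdist\<close> would be 0 there. *)
definition metric_outer_measure :: "('a::metric_space set \<Rightarrow> ennreal) \<Rightarrow> bool" where
  "metric_outer_measure \<mu> \<longleftrightarrow>
     outer_measure_space (Pow UNIV) \<mu> \<and>
     (\<forall>E F. (INF x\<in>E. INF y\<in>F. ennreal (dist x y)) > 0 \<longrightarrow> \<mu> (E \<union> F) = \<mu> E + \<mu> F)"

(* \<open>countably_subadditive\<close> only mentions disjoint sequences; together with monotonicity on the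
   full power set this gives the usual subadditivity over arbitrary sequences. *)
lemma outer_measure_space_UN_le:
  assumes "outer_measure_space (Pow UNIV) \<mu>"
  shows "\<mu> (\<Union>i. A i) \<le> (\<Sum>i. \<mu> (A i))"
proof -
  have mono: "\<mu> X \<le> \<mu> Y" if "X \<subseteq> Y" for X Y
    using assms that by (auto simp: outer_measure_space_def increasing_def)
  have "\<mu> (\<Union>i. disjointed A i) \<le> (\<Sum>i. \<mu> (disjointed A i))"
    using assms disjoint_family_disjointed[of A]
    by (auto simp: outer_measure_space_def countably_subadditive_def)
  also have "\<dots> \<le> (\<Sum>i. \<mu> (A i))"
    by (intro suminf_le mono disjointed_subset summableI)
  finally show ?thesis by (simp add: UN_disjointed_eq)
qed

end

theory Submission
  imports Defs
begin

text \<open>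
  A cube of side \<open>2\<^sup>-\<^sup>k\<close> has diameter at most \<open>n 2\<^sup>-\<^sup>k\<close>, so for large \<open>k\<close> it cannot meet both of two sets
  at positive distance. Hence the cube numbers, and after passing to the lower limit the
  premeasures, are superadditive on separated sets; summing over a cover gives the metric property.
  The Borel part is Caratheodory's criterion: for a closed set \<open>C\<close>, the set \<open>X - C\<close> is exhausted
  by the sets of points at distance at least \<open>1 / (n + 1)\<close> from \<open>C\<close>, which are separated from
  \<open>X \<inter> C\<close>; the errors are controlled because every second ring
  \<open>1 / (k + 2) \<le> infdist x C < 1 / (k + 1)\<close> is separated from the earlier ones, so that the
  measures of all the rings have sum at most \<open>2 \<mu> X\<close>.
\<close>

section \<open>Caratheodory's criterion for metric outer measures\<close>

text \<open>\<open>countably_subadditive\<close> speaks of disjoint families only, so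
  \<open>B\<close> is first replaced by \<open>B - A\<close> and monotonicity restores
  \<open>B\<close>.\<close>

lemma outer_measure_space_Un_le:
  assumes "outer_measure_space (Pow UNIV) \<mu>"
  shows "\<mu> (A \<union> B) \<le> \<mu> A + \<mu> B"
proof -
  have "countably_subadditive (Pow UNIV) \<mu>" "positive (Pow UNIV) \<mu>"
    using assms by (auto simp: outer_measure_space_def)
  then have "subadditive (Pow UNIV) \<mu>"
    by (intro ring_of_sets.countably_subadditive_subadditive[OF ring_of_sets_Pow])
  then have "\<mu> (A \<union> (B - A)) \<le> \<mu> A + \<mu> (B - A)"
    by (rule subadditiveD) auto
  also have "\<mu> (B - A) \<le> \<mu> B"
    using assms by (auto simp: outer_measure_space_def increasing_def)
  finally show ?thesis by (simp add: add_left_mono)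
qed

lemma metric_outer_measure_add:
  assumes "metric_outer_measure \<mu>" and "d > 0"
    and "\<And>x y. x \<in> E \<Longrightarrow> y \<in> F \<Longrightarrow> d \<le> dist x y"
  shows "\<mu> (E \<union> F) = \<mu> E + \<mu> F"
proof -
  have "0 < ennreal d" using \<open>d > 0\<close> by simp
  also have "ennreal d \<le> (INF x\<in>E. INF y\<in>F. ennreal (dist x y))"
    using assms(3) by (intro INF_greatest ennreal_leI)
  finally show ?thesis using assms(1) by (simp add: metric_outer_measure_def)
qed

lemma metric_outer_measure_mono:
  assumes "metric_outer_measure \<mu>" "A \<subseteq> B"
  shows "\<mu> A \<le> \<mu> B"
  using assms by (auto simp: metric_outer_measure_def outer_measure_space_def increasing_def)

lemma metric_outer_measure_empty:
  assumes "metric_outer_measure \<mu>"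
  shows "\<mu> {} = 0"
  using assms by (auto simp: metric_outer_measure_def outer_measure_space_def positive_def)

lemma metric_outer_measure_UN_le:
  assumes "metric_outer_measure \<mu>"
  shows "\<mu> (\<Union>i. A i) \<le> (\<Sum>i. \<mu> (A i))"
  using assms by (intro outer_measure_space_UN_le) (simp add: metric_outer_measure_def)

lemma metric_outer_measure_Un_le:
  assumes "metric_outer_measure \<mu>"
  shows "\<mu> (A \<union> B) \<le> \<mu> A + \<mu> B"
  using assms by (intro outer_measure_space_Un_le) (simp add: metric_outer_measure_def)

text \<open>Neighbouring rings have no gap between them, so separation is available only between
  rings whose indices differ by at least two.\<close>

definition distance_ring :: "'a::metric_space set \<Rightarrow> nat \<Rightarrow> 'a set" where
  "distance_ring C k = {x. 1 / real (k + 2) \<le> infdist x C \<and> infdist x C < 1 / real (k + 1)}"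

lemma infdist_diff_le_dist: "infdist x C - infdist y C \<le> dist x y"
  using infdist_triangle[of x C y] by simp

text \<open>The offset \<open>b\<close> selects the parity. Ring \<open>2 * N + b\<close> is
  separated from the union of the earlier ones because \<open>infdist\<close> is 1-Lipschitz, so
  induction turns the sum into the measure of a union inside \<open>X\<close>.\<close>

lemma sum_alternate_distance_rings_le:
  assumes \<mu>: "metric_outer_measure \<mu>"
  shows "(\<Sum>k<N. \<mu> (X \<inter> distance_ring C (2 * k + b))) \<le> \<mu> X"
proof -
  let ?D = "\<lambda>k. X \<inter> distance_ring C (2 * k + b)"
  have "(\<Sum>k<N. \<mu> (?D k)) = \<mu> (\<Union>k<N. ?D k)"
  proof (induction N)
    case 0
    then show ?case by (simp add: metric_outer_measure_empty[OF \<mu>])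
  next
    case (Suc N)
    show ?case
    proof (cases "N = 0")
      case False
      \<comment> \<open>This is the width of the omitted ring \<open>2 * N + b - 1\<close>. For
        \<open>N = b = 0\<close> it would be -1, since 1 / 0 = 0; hence the case split.\<close>
      define d where "d = 1 / real (2 * N + b) - 1 / real (2 * N + b + 1)"
      have "d > 0" using False by (simp add: d_def frac_less2)
      moreover have "d \<le> dist x y" if x: "x \<in> (\<Union>k<N. ?D k)" and y: "y \<in> ?D N" for x y
      proof -
        obtain k where k: "k < N" "1 / real (2 * k + b + 2) \<le> infdist x C"
          using x by (auto simp: distance_ring_def)
        have "1 / real (2 * N + b) \<le> 1 / real (2 * k + b + 2)"
          using k(1) by (intro divide_left_mono) auto
        also note k(2)
        finally have "1 / real (2 * N + b) \<le> infdist x C" .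
        moreover have "infdist y C < 1 / real (2 * N + b + 1)"
          using y by (auto simp: distance_ring_def)
        ultimately show ?thesis
          using infdist_diff_le_dist[of x C y] by (simp add: d_def)
      qed
      ultimately have "\<mu> ((\<Union>k<N. ?D k) \<union> ?D N) = \<mu> (\<Union>k<N. ?D k) + \<mu> (?D N)"
        by (rule metric_outer_measure_add[OF \<mu>])
      moreover have "(\<Union>k<Suc N. ?D k) = (\<Union>k<N. ?D k) \<union> ?D N" by (auto simp: less_Suc_eq)
      ultimately show ?thesis using Suc.IH by (simp only: sum.lessThan_Suc)
    qed (simp add: lessThan_Suc)
  qed
  also have "\<dots> \<le> \<mu> X" by (intro metric_outer_measure_mono[OF \<mu>]) auto
  finally show ?thesis .
qed

lemma suminf_distance_rings_le:
  assumes \<mu>: "metric_outer_measure \<mu>"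
  shows "(\<Sum>k. \<mu> (X \<inter> distance_ring C k)) \<le> 2 * \<mu> X"
proof (rule suminf_le_const[OF summableI])
  fix n
  let ?f = "\<lambda>k. \<mu> (X \<inter> distance_ring C k)"
  have "sum ?f {..<n} \<le> sum ?f {..<2 * n}" by (intro sum_mono2) auto
  also have "sum ?f {..<2 * n} = (\<Sum>k<n. ?f (2 * k + 0)) + (\<Sum>k<n. ?f (2 * k + 1))"
    by (induction n) (simp_all add: ac_simps)
  also have "\<dots> \<le> \<mu> X + \<mu> X"
    by (intro add_mono sum_alternate_distance_rings_le[OF \<mu>])
  finally show "sum ?f {..<n} \<le> 2 * \<mu> X" by (simp add: mult_2)
qed

text \<open>Closedness makes \<open>infdist x C\<close> positive off \<open>C\<close>; nonemptiness
  matters because \<open>infdist x {} = 0\<close>.\<close>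

lemma diff_closed_subset_distance_rings:
  assumes "closed C" "C \<noteq> {}"
  shows "X - C \<subseteq> {x \<in> X. 1 / real (n + 1) \<le> infdist x C} \<union> (\<Union>k. X \<inter> distance_ring C (k + n))"
proof
  fix x assume x: "x \<in> X - C"
  define r where "r = infdist x C"
  have "r > 0" using x assms
    by (metis DiffD2 in_closed_iff_infdist_zero infdist_nonneg less_eq_real_def r_def)
  show "x \<in> {x \<in> X. 1 / real (n + 1) \<le> infdist x C} \<union> (\<Union>k. X \<inter> distance_ring C (k + n))"
  proof (cases "1 / real (n + 1) \<le> r")
    case False
    let ?P = "\<lambda>m. 1 / real (m + n + 1) \<le> r"
    obtain m where "inverse (real (Suc m)) < r" using reals_Archimedean[OF \<open>r > 0\<close>] by auto
    moreover have "1 / real (m + n + 1) \<le> inverse (real (Suc m))"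
      by (simp add: divide_simps)
    ultimately have P: "?P m" by linarith
    \<comment> \<open>The failed case excludes \<open>l = 0\<close>. Minimality at the predecessor
      \<open>k\<close> of \<open>l\<close> gives the strict upper bound of ring
      \<open>k + n\<close>, and \<open>l\<close> itself gives the lower one.\<close>
    define l where "l = (LEAST m. ?P m)"
    have l: "?P l" unfolding l_def by (rule LeastI[of ?P, OF P])
    with False obtain k where k: "l = Suc k" by (cases l) auto
    then have "\<not> ?P k" using not_less_Least[of k ?P] by (simp add: l_def)
    then have "x \<in> distance_ring C (k + n)"
      using l k by (simp add: distance_ring_def r_def add_ac)
    then show ?thesis using x by auto
  qed (use x r_def in auto)
qed

lemma metric_outer_measure_closed_split:
  assumes \<mu>: "metric_outer_measure \<mu>" and "closed C"
  shows "\<mu> (X \<inter> C) + \<mu> (X - C) \<le> \<mu> X"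
proof (cases "C = {} \<or> \<mu> X = top")
  case True
  then show ?thesis by (auto simp: metric_outer_measure_empty[OF \<mu>])
next
  case False
  let ?f = "\<lambda>k. \<mu> (X \<inter> distance_ring C k)"
  let ?far = "\<lambda>n. {x \<in> X. 1 / real (n + 1) \<le> infdist x C}"
  have "suminf ?f \<le> 2 * \<mu> X" by (rule suminf_distance_rings_le[OF \<mu>])
  also have "\<dots> < top" using False by (simp add: ennreal_mult_less_top less_top)
  finally have fin: "suminf ?f < top" .
  \<comment> \<open>Adding the finite total to both sides replaces the limit in \<open>n\<close>:
    the first \<open>n\<close> terms and the tail error recombine to \<open>suminf ?f\<close>, which
    is cancelled at the end.\<close>
  have "suminf ?f + (\<mu> (X \<inter> C) + \<mu> (X - C)) \<le> suminf ?f + \<mu> X"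
  proof (rule ennreal_suminf_bound_add)
    fix n
    have "\<mu> (X - C) \<le> \<mu> (?far n \<union> (\<Union>k. X \<inter> distance_ring C (k + n)))"
      using False assms by (intro metric_outer_measure_mono[OF \<mu>] diff_closed_subset_distance_rings) auto
    also have "\<dots> \<le> \<mu> (?far n) + \<mu> (\<Union>k. X \<inter> distance_ring C (k + n))"
      by (rule metric_outer_measure_Un_le[OF \<mu>])
    also have "\<dots> \<le> \<mu> (?far n) + (\<Sum>k. ?f (k + n))"
      by (intro add_left_mono metric_outer_measure_UN_le[OF \<mu>])
    finally have "\<mu> (X \<inter> C) + \<mu> (X - C) \<le> (\<mu> (X \<inter> C) + \<mu> (?far n)) + (\<Sum>k. ?f (k + n))"
      by (simp add: add_left_mono add.assoc)
    also have "\<mu> (X \<inter> C) + \<mu> (?far n) = \<mu> ((X \<inter> C) \<union> ?far n)"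
    proof (rule metric_outer_measure_add[OF \<mu>, symmetric])
      show "1 / real (n + 1) \<le> dist x y" if "x \<in> X \<inter> C" "y \<in> ?far n" for x y
        using that infdist_le[of x C y] by (auto simp: dist_commute)
    qed simp
    also have "\<dots> \<le> \<mu> X" by (intro metric_outer_measure_mono[OF \<mu>]) auto
    finally have "\<mu> (X \<inter> C) + \<mu> (X - C) \<le> \<mu> X + (\<Sum>k. ?f (k + n))"
      by (simp add: add_right_mono)
    then have "sum ?f {..<n} + (\<mu> (X \<inter> C) + \<mu> (X - C)) \<le> sum ?f {..<n} + (\<mu> X + (\<Sum>k. ?f (k + n)))"
      by (rule add_left_mono)
    also have "\<dots> = ((\<Sum>k. ?f (k + n)) + sum ?f {..<n}) + \<mu> X" by (simp add: ac_simps)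
    also have "(\<Sum>k. ?f (k + n)) + sum ?f {..<n} = suminf ?f"
      by (rule suminf_offset[OF summableI, symmetric])
    finally show "sum ?f {..<n} + (\<mu> (X \<inter> C) + \<mu> (X - C)) \<le> suminf ?f + \<mu> X" .
  qed
  then show ?thesis using fin by (auto simp: ennreal_add_left_cancel_le)
qed

theorem metric_outer_measure_borel:
  fixes \<mu> :: "'a::metric_space set \<Rightarrow> ennreal"
  assumes \<mu>: "metric_outer_measure \<mu>"
  shows "measure_space UNIV (sets borel) \<mu>"
proof -
  \<comment> \<open>\<open>L\<close> consists of the Caratheodory measurable sets, a sigma-algebra
    on which \<open>\<mu>\<close> is a measure. It suffices that it contains the closed sets, which
    generate \<open>borel\<close>.\<close>
  define L where "L = lambda_system UNIV (Pow UNIV) \<mu>"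
  have ms: "measure_space UNIV L \<mu>"
    using \<mu> unfolding L_def metric_outer_measure_def
    by (intro sigma_algebra.caratheodory_lemma[OF sigma_algebra_Pow]) auto
  then interpret L: sigma_algebra UNIV L by (simp add: measure_space_def)
  have "C \<in> L" if "closed C" for C
  proof -
    have "\<mu> (X \<inter> C) + \<mu> (X - C) = \<mu> X" for X
    proof (rule antisym)
      show "\<mu> X \<le> \<mu> (X \<inter> C) + \<mu> (X - C)"
        using metric_outer_measure_Un_le[OF \<mu>, of "X \<inter> C" "X - C"]
        by (simp add: Int_Diff_Un)
    qed (rule metric_outer_measure_closed_split[OF \<mu> that])
    then show ?thesis
      unfolding L_def algebra.lambda_system_eq[OF algebra_Pow] by simp
  qed
  then have "sigma_sets UNIV (Collect closed) \<subseteq> L"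
    by (intro L.sigma_sets_subset) auto
  then have "sets borel \<subseteq> L" by (simp add: borel_eq_closed)
  then show ?thesis
    using measure_down[OF ms] sets.sigma_algebra_axioms[of borel] by simp
qed

section \<open>The box-counting premeasure\<close>

text \<open>The Euclidean norm is bounded by the sum of the coordinate differences. This crude bound
  suffices, as it tends to 0.\<close>

lemma binary_cube_dist_le:
  fixes x y :: "real ^ 'n"
  assumes "Q \<in> binary_cubes k" "x \<in> Q" "y \<in> Q"
  shows "dist x y \<le> real CARD('n) * (1 / 2) ^ k"
proof -
  obtain p :: "'n \<Rightarrow> int"
    where Q: "Q = {x. \<forall>i. x $ i \<in> {of_int (p i) * 2 powr - real k ..<
                            (of_int (p i) + 1) * 2 powr - real k}}"
    using assms(1) by (auto simp: binary_cubes_def)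
  have "\<bar>(x - y) $ i\<bar> \<le> 2 powr - real k" for i
  proof -
    have "of_int (p i) * 2 powr - real k \<le> x $ i" "x $ i < (of_int (p i) + 1) * 2 powr - real k"
      "of_int (p i) * 2 powr - real k \<le> y $ i" "y $ i < (of_int (p i) + 1) * 2 powr - real k"
      using assms(2,3) by (auto simp: Q)
    then show ?thesis unfolding distrib_right by (simp add: abs_le_iff)
  qed
  then have "(\<Sum>i\<in>UNIV. \<bar>(x - y) $ i\<bar>) \<le> real CARD('n) * 2 powr - real k"
    by (intro sum_bounded_above)
  then have "dist x y \<le> real CARD('n) * 2 powr - real k"
    using norm_le_l1_cart[of "x - y"] by (simp add: dist_norm)
  then show ?thesis by (simp add: powr_minus powr_realpow power_one_over inverse_eq_divide)
qed

lemma eventually_no_binary_cube_meets_both: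
  fixes E F :: "(real ^ 'n) set"
  assumes "d > 0" and "\<And>x y. x \<in> E \<Longrightarrow> y \<in> F \<Longrightarrow> d \<le> dist x y"
  shows "eventually (\<lambda>k. \<forall>Q\<in>binary_cubes k. Q \<inter> E = {} \<or> Q \<inter> F = {}) sequentially"
proof -
  have "(\<lambda>k. real CARD('n) * (1 / 2) ^ k) \<longlonglongrightarrow> real CARD('n) * 0"
    by (intro tendsto_mult_left LIMSEQ_power_zero) simp
  then have "eventually (\<lambda>k. real CARD('n) * (1 / 2) ^ k < d) sequentially"
    using \<open>d > 0\<close> by (intro order_tendstoD(2)) auto
  then show ?thesis
  proof eventually_elim
    case (elim k)
    show ?case
    proof (intro ballI)
      fix Q :: "(real ^ 'n) set" assume "Q \<in> binary_cubes k"
      then show "Q \<inter> E = {} \<or> Q \<inter> F = {}"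
        using elim assms(2) binary_cube_dist_le[of Q k]
        by (meson disjoint_iff not_le order_trans)
    qed
  qed
qed

lemma cube_number_mono: "E \<subseteq> F \<Longrightarrow> cube_number k E \<le> cube_number k F"
  unfolding cube_number_def by (intro INF_superset_mono) auto

text \<open>In any cover of \<open>E \<union> F\<close>, the cubes meeting \<open>E\<close> and
  those meeting \<open>F\<close> form disjoint subfamilies that cover \<open>E\<close> and
  \<open>F\<close> respectively.\<close>

lemma cube_number_superadditive:
  fixes E F :: "(real ^ 'n) set"
  assumes sep: "\<And>Q. Q \<in> binary_cubes k \<Longrightarrow> Q \<inter> E = {} \<or> Q \<inter> F = {}"
  shows "cube_number k E + cube_number k F \<le> cube_number k (E \<union> F)"
  unfolding cube_number_def[of k "E \<union> F"]
proof (rule INF_greatest)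
  fix \<C> :: "(real ^ 'n) set set"
  let ?M = "count_space UNIV :: (real ^ 'n) set measure"
  let ?hit = "\<lambda>E. {Q \<in> \<C>. Q \<inter> E \<noteq> {}}"
  assume "\<C> \<in> {\<C>. \<C> \<subseteq> binary_cubes k \<and> E \<union> F \<subseteq> \<Union>\<C>}"
  then have \<C>: "\<C> \<subseteq> binary_cubes k" "E \<subseteq> \<Union>\<C>" "F \<subseteq> \<Union>\<C>" by auto
  have "cube_number k G \<le> emeasure ?M (?hit G)" if "G \<subseteq> \<Union>\<C>" for G
    unfolding cube_number_def using that \<C>(1) by (intro INF_lower) blast
  then have "cube_number k E + cube_number k F \<le> emeasure ?M (?hit E) + emeasure ?M (?hit F)"
    using \<C> by (intro add_mono)
  also have "\<dots> = emeasure ?M (?hit E \<union> ?hit F)"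
    using sep \<C>(1) by (intro plus_emeasure) auto
  also have "\<dots> \<le> emeasure ?M \<C>" by (intro emeasure_mono) auto
  finally show "cube_number k E + cube_number k F \<le> emeasure ?M \<C>" .
qed

lemma box_premeasure_mono:
  assumes "E \<subseteq> F"
  shows "box_premeasure t E \<le> box_premeasure t F"
  unfolding box_premeasure_def box_premeasure_at_def
  using assms by (intro Liminf_mono always_eventually allI mult_right_mono cube_number_mono) auto

text \<open>Tail infima increase with \<open>n\<close>, so their suprema add up; on each tail the
  sum of the infima bounds every \<open>f m + g m\<close> from below.\<close>

lemma ennreal_liminf_add_le:
  fixes f g :: "nat \<Rightarrow> ennreal"
  shows "liminf f + liminf g \<le> liminf (\<lambda>n. f n + g n)"
proof -
  have inc: "incseq (\<lambda>n. INF m\<in>{n..}. h m)" for h :: "nat \<Rightarrow> ennreal"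
    by (intro incseq_SucI INF_superset_mono) auto
  have "liminf f + liminf g = (SUP n. (INF m\<in>{n..}. f m) + (INF m\<in>{n..}. g m))"
    unfolding liminf_SUP_INF by (rule ennreal_SUP_add[OF inc inc, symmetric])
  also have "\<dots> \<le> liminf (\<lambda>n. f n + g n)"
    unfolding liminf_SUP_INF by (intro SUP_mono' INF_greatest add_mono INF_lower)
  finally show ?thesis .
qed

lemma box_premeasure_superadditive:
  fixes E F :: "(real ^ 'n) set"
  assumes "d > 0" and "\<And>x y. x \<in> E \<Longrightarrow> y \<in> F \<Longrightarrow> d \<le> dist x y"
  shows "box_premeasure t E + box_premeasure t F \<le> box_premeasure t (E \<union> F)"
proof -
  have "box_premeasure t E + box_premeasure t F
      \<le> liminf (\<lambda>k. box_premeasure_at t k E + box_premeasure_at t k F)"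
    unfolding box_premeasure_def by (rule ennreal_liminf_add_le)
  also have "\<dots> \<le> box_premeasure t (E \<union> F)"
    unfolding box_premeasure_def
  proof (rule Liminf_mono)
    have "eventually (\<lambda>k. \<forall>Q\<in>binary_cubes k. Q \<inter> E = {} \<or> Q \<inter> F = {}) sequentially"
      using assms by (rule eventually_no_binary_cube_meets_both)
    then show "eventually (\<lambda>k. box_premeasure_at t k E + box_premeasure_at t k F
        \<le> box_premeasure_at t k (E \<union> F)) sequentially"
    proof eventually_elim
      case (elim k)
      then show ?case unfolding box_premeasure_at_def distrib_right[symmetric]
        by (intro mult_right_mono cube_number_superadditive) auto
    qed
  qed
  finally show ?thesis .
qed

section \<open>The measure built from the premeasure\<close>

lemma box_measure_le:
  "E \<subseteq> (\<Union>i. A i) \<Longrightarrow> box_measure t E \<le> (\<Sum>i. box_premeasure t (A i))"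
  unfolding box_measure_def by (rule INF_lower) simp

lemma box_premeasure_positive: "positive (Pow UNIV) (box_premeasure t)"
  by (simp add: positive_def box_premeasure_empty)

lemma box_premeasure_increasing: "increasing (Pow UNIV) (box_premeasure t)"
  by (simp add: increasing_def box_premeasure_mono)

text \<open>\<open>outer_measure\<close> admits only disjoint covers. Making a cover disjoint
  shrinks its members, so by monotonicity the sum does not grow and the infima agree.\<close>

lemma box_measure_eq_outer_measure:
  "box_measure t = outer_measure (Pow UNIV) (box_premeasure t)"
proof (intro ext antisym)
  fix E :: "(real ^ 'n) set"
  show "box_measure t E \<le> outer_measure (Pow UNIV) (box_premeasure t) E"
    unfolding outer_measure_def by (intro INF_greatest box_measure_le) auto
  show "outer_measure (Pow UNIV) (box_premeasure t) E \<le> box_measure t E"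
    unfolding box_measure_def
    by (intro INF_greatest ring_of_sets.outer_measure_le[OF ring_of_sets_Pow
          box_premeasure_positive box_premeasure_increasing]) auto
qed

lemma outer_measure_space_box_measure:
  "outer_measure_space (Pow UNIV) (box_measure t)"
  unfolding box_measure_eq_outer_measure
  by (rule ring_of_sets.outer_measure_space_outer_measure[OF ring_of_sets_Pow
        box_premeasure_positive box_premeasure_increasing])

text \<open>Each member of a cover of \<open>E \<union> F\<close> is cut into its traces on
  \<open>E\<close> and \<open>F\<close>. The traces inherit the separation, so the premeasure is
  superadditive on them.\<close>

lemma box_measure_superadditive:
  fixes E F :: "(real ^ 'n) set"
  assumes "d > 0" and "\<And>x y. x \<in> E \<Longrightarrow> y \<in> F \<Longrightarrow> d \<le> dist x y"
  shows "box_measure t E + box_measure t F \<le> box_measure t (E \<union> F)"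
  unfolding box_measure_def[of t "E \<union> F"]
proof (rule INF_greatest)
  fix A :: "nat \<Rightarrow> (real ^ 'n) set"
  assume "A \<in> {A. E \<union> F \<subseteq> (\<Union>i. A i)}"
  then have A: "E \<subseteq> (\<Union>i. A i \<inter> E)" "F \<subseteq> (\<Union>i. A i \<inter> F)" by auto
  have "box_measure t E + box_measure t F
      \<le> (\<Sum>i. box_premeasure t (A i \<inter> E)) + (\<Sum>i. box_premeasure t (A i \<inter> F))"
    by (intro add_mono box_measure_le A)
  also have "\<dots> = (\<Sum>i. box_premeasure t (A i \<inter> E) + box_premeasure t (A i \<inter> F))"
    by (intro suminf_add summableI)
  also have "\<dots> \<le> (\<Sum>i. box_premeasure t (A i))"
  proof (intro suminf_le summableI)
    fix i
    have "box_premeasure t (A i \<inter> E) + box_premeasure t (A i \<inter> F)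
        \<le> box_premeasure t ((A i \<inter> E) \<union> (A i \<inter> F))"
      using assms by (intro box_premeasure_superadditive[of d]) auto
    also have "\<dots> \<le> box_premeasure t (A i)" by (intro box_premeasure_mono) auto
    finally show "box_premeasure t (A i \<inter> E) + box_premeasure t (A i \<inter> F) \<le> box_premeasure t (A i)" .
  qed
  finally show "box_measure t E + box_measure t F \<le> (\<Sum>i. box_premeasure t (A i))" .
qed

lemma ennreal_INF_dist_posE:
  assumes "(INF x\<in>E. INF y\<in>F. ennreal (dist x y)) > 0"
  obtains d where "d > 0" and "\<And>x y. x \<in> E \<Longrightarrow> y \<in> F \<Longrightarrow> d \<le> dist x y"
proof -
  \<comment> \<open>The infimum is infinite when \<open>E\<close> or \<open>F\<close> is empty; a
    value strictly below it is finite and so comes from a real \<open>d\<close>.\<close>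
  obtain e :: ennreal where e: "0 < e" "e < (INF x\<in>E. INF y\<in>F. ennreal (dist x y))"
    using dense[OF assms] by blast
  then obtain d where d: "e = ennreal d" "d > 0"
    by (cases e) auto
  have "d \<le> dist x y" if "x \<in> E" "y \<in> F" for x y
  proof -
    have "e \<le> ennreal (dist x y)"
      using e(2) that by (meson INF_lower2 le_INF_iff less_imp_le)
    then show ?thesis by (simp add: d)
  qed
  with d(2) show ?thesis by (rule that)
qed

lemma metric_outer_measure_box_measure:
  "metric_outer_measure (box_measure t :: (real ^ 'n) set \<Rightarrow> ennreal)"
  unfolding metric_outer_measure_def
proof (intro conjI allI impI antisym)
  show oms: "outer_measure_space (Pow UNIV) (box_measure t :: (real ^ 'n) set \<Rightarrow> ennreal)"
    by (rule outer_measure_space_box_measure)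
  fix E F :: "(real ^ 'n) set"
  show "box_measure t (E \<union> F) \<le> box_measure t E + box_measure t F"
    by (rule outer_measure_space_Un_le[OF oms])
  assume "(INF x\<in>E. INF y\<in>F. ennreal (dist x y)) > 0"
  then show "box_measure t E + box_measure t F \<le> box_measure t (E \<union> F)"
    by (elim ennreal_INF_dist_posE) (rule box_measure_superadditive)
qed

theorem proposition1:
  fixes t :: real
  assumes "t \<ge> 0"
  shows "metric_outer_measure (box_measure t :: (real ^ 'n) set \<Rightarrow> ennreal)
       \<and> measure_space UNIV (sets borel) (box_measure t :: (real ^ 'n) set \<Rightarrow> ennreal)"
  using metric_outer_measure_box_measure metric_outer_measure_borel by blast

end
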